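(* Under the standing assumptions in the context, the following assertions hold. (i) For $\mathbb P$-almost every $\omega\in\Omega$, it is equivalent to minimize $J_{\omega,N}$ and $\mathcal J_{\omega,N}$; minimizers of the latter are supported on the set of minimizers of the former (i.e. if $\gamma_N=\frac1N\sum_{i=1}^N\delta_{x_i}\otimes\nu_i$ minimizes $\mathcal J_{\omega,N}$, then $\nu_1\otimes\dots\otimes\nu_N$ is concentrated on $\operatorname{argmin}J_{\omega,N}\subset\mathcal Y^N$); and $$\min_{\mathcal Y^{N}}J_{\omega,N}=\min_{\mathscr P^{\mathrm{pure}}_{\mu_N}(\mathcal X\times\mathcal Y)}\mathcal J_{\omega,N}=\min_{\mathscr P_{\mu_N}(\mathcal X\times\mathcal Y)}\mathcal J_{\omega,N}.$$ (ii) For such $\omega$, let $(y_i)_{i=1}^N\in\operatorname{argmin}J_{\omega,N}$ and $\gamma_N=\frac1N\sum_{i=1}^N\delta_{x_i}\otimes\nu_{\omega,i}\in\operatorname{argmin}\mathcal J_{\omega,N}$. Then $(y_i)_{i=1}^N$ (via the profile $(\delta_{y_i})_{i=1}^N$) and $(\nu_{\omega,i})_{i=1}^N$ induce Nash equilibria for the closed-loop $N$-player game.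
   Context: Standing assumptions: $\mathcal X,\mathcal Y$ are Polish spaces; $\mu\in\mathscr P(\mathcal X)$ (Borel probability measures) is atomless; $c:\mathcal X\times\mathcal Y\to[0,+\infty]$, $L:\mathcal Y\to[0,+\infty]$, $H:\mathcal Y\times\mathcal Y\to[0,+\infty]$ are lower semi-continuous; $H$ is symmetric; $\{L\le\kappa\}$ is compact for every $\kappa>0$. $(\Omega,\mathcal F,\mathbb P)$ is a probability space carrying an i.i.d. sequence $(X_i)_{i\in\mathbb N}$ of $\mathcal X$-valued random variables with law $\mu$; $N$ is a positive integer. Notation: $\mathcal L(\nu)=\int L\,d\nu$, $\mathcal H(\nu,\bar\nu)=\int H\,d\nu\otimes\bar\nu$. For $\omega\in\Omega$ put $x_i=X_i(\omega)$ and $\mu_N=\mu_N(\omega)=\frac1N\sum_{i=1}^N\delta_{x_i}$; $\mathscr P_{\mu_N}(\mathcal X\times\mathcal Y)$ is the set of probability measures on $\mathcal X\times\mathcal Y$ with first marginal $\mu_N$. For $\mathbb P$-a.e. $\omega$ the $x_i$ are pairwise distinct, and then each $\gamma_N\in\mathscr P_{\mu_N}(\mathcal X\times\mathcal Y)$ is uniquely written $\gamma_N=\frac1N\sum_{i=1}^N\delta_{x_i}\otimes\nu_i$, $\nu_i\in\mathscr P(\mathcal Y)$. Define $$\mathcal J_{\omega,N}(\gamma_N)=\int c\,d\gamma_N+\frac1N\sum_{i=1}^N\mathcal L(\nu_i)+\frac1{N^2}\sum_{i\ne j}\mathcal H(\nu_i,\nu_j)$$ for $\gamma_N\in\mathscr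 P_{\mu_N}(\mathcal X\times\mathcal Y)$, $+\infty$ otherwise; $J_{\omega,N}(y_1,\dots,y_N)=\mathcal J_{\omega,N}\big(\frac1N\sum_{i=1}^N\delta_{(x_i,y_i)}\big)$ for $(y_1,\dots,y_N)\in\mathcal Y^N$; and $\mathscr P^{\mathrm{pure}}_{\mu_N}(\mathcal X\times\mathcal Y)$ is the set of measures of the form $\frac1N\sum_{i=1}^N\delta_{(x_i,y_i)}$. Closed-loop game: player $i\in\{1,\dots,N\}$ chooses $\nu_i\in\mathscr P(\mathcal Y)$ to minimize $$J_{\omega,i}(\nu_i,\nu_{-i})=\int_{\mathcal Y}c(x_i,y)\,d\nu_i(y)+\mathcal L(\nu_i)+\frac2N\sum_{j\ne i}\mathcal H(\nu_i,\nu_j).$$ A profile $(\nu_i)_{i=1}^N$ is a Nash equilibrium if $J_{\omega,i}(\nu_i,\nu_{-i})\le J_{\omega,i}(\bar\nu_i,\nu_{-i})$ for all $i$ and all $\bar\nu_i\in\mathscr P(\mathcal Y)$; a profile in pure strategies is one with $\nu_i=\delta_{y_i}$ for all $i$.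
   Formalization: In (ii) the minimizers are assumed to have finite cost (J(y) < +∞, resp. 𝒥(γ_N) < +∞); if J is identically +∞, every profile is a minimizer and need not be a Nash equilibrium. *)

theory Defs
  imports "HOL-Probability.Probability"
begin

definition lsc :: "('a::topological_space \<Rightarrow> ennreal) \<Rightarrow> bool" where
  "lsc f \<longleftrightarrow> (\<forall>x. \<forall>t<f x. eventually (\<lambda>z. t < f z) (nhds x))"

text \<open>An atom is a set of positive measure that cannot be split into two parts of smaller measure.\<close>

definition atomless :: "'a measure \<Rightarrow> bool" where
  "atomless M \<longleftrightarrow> \<not> (\<exists>A\<in>sets M. 0 < emeasure M A \<and>
     (\<forall>B\<in>sets M. B \<subseteq> A \<longrightarrow> emeasure M B = 0 \<or> emeasure M B = emeasure M A))"

definition argmin_on :: "'a set \<Rightarrow> ('a \<Rightarrow> ennreal) \<Rightarrow> 'a set" where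
  "argmin_on S f = {x. is_arg_min f (\<lambda>x. x \<in> S) x}"

text \<open>The set of Borel probability measures.\<close>

abbreviation borel_probs :: "'a::topological_space measure set" where
  "borel_probs \<equiv> space (prob_algebra borel)"

text \<open>The average \<open>(\<kappa> 1 + \<dots> + \<kappa> N) / N\<close> of Borel measures.\<close>

definition avg_measure :: "nat \<Rightarrow> (nat \<Rightarrow> 'a::topological_space measure) \<Rightarrow> 'a measure" where
  "avg_measure N \<kappa> =
     measure_of UNIV (sets borel) (\<lambda>A. (\<Sum>i\<in>{1..N}. emeasure (\<kappa> i) A) / of_nat N)"

lemma sets_avg_measure [simp]: "sets (avg_measure N \<kappa>) = sets borel"
  unfolding avg_measure_def
  by (metis sets.sigma_sets_eq sets_measure_of space_borel subset_UNIV Pow_UNIV)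

lemma emeasure_avg_measure:
  assumes s: "\<And>i. i \<in> {1..N} \<Longrightarrow> sets (\<kappa> i) = sets borel" and A: "A \<in> sets borel"
  shows "emeasure (avg_measure N \<kappa>) A = (\<Sum>i\<in>{1..N}. emeasure (\<kappa> i) A) / of_nat N"
proof -
  let ?f = "\<lambda>A. (\<Sum>i\<in>{1..N}. emeasure (\<kappa> i) A) / of_nat N"
  have "countably_additive (sets borel) ?f"
  proof (rule countably_additiveI)
    fix B :: "nat \<Rightarrow> 'a set"
    assume B: "range B \<subseteq> sets borel" "disjoint_family B"
    have "(\<Sum>n. ?f (B n)) = (\<Sum>n. \<Sum>i\<in>{1..N}. emeasure (\<kappa> i) (B n)) / of_nat N"
      by (simp add: divide_ennreal_def)
    also have "(\<Sum>n. \<Sum>i\<in>{1..N}. emeasure (\<kappa> i) (B n))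
        = (\<Sum>i\<in>{1..N}. \<Sum>n. emeasure (\<kappa> i) (B n))"
      by (intro suminf_sum) auto
    also have "\<dots> = (\<Sum>i\<in>{1..N}. emeasure (\<kappa> i) (\<Union>n. B n))"
      using B s by (intro sum.cong refl suminf_emeasure) auto
    finally show "(\<Sum>n. ?f (B n)) = ?f (\<Union>n. B n)" .
  qed
  moreover have "positive (sets borel) ?f"
    by (simp add: positive_def)
  moreover have "sigma_algebra UNIV (sets (borel :: 'a measure))"
    by (metis sets.sigma_algebra_axioms space_borel)
  ultimately show ?thesis
    unfolding avg_measure_def using A by (intro emeasure_measure_of_sigma)
qed

definition empirical :: "nat \<Rightarrow> (nat \<Rightarrow> 'a::topological_space) \<Rightarrow> 'a measure" where
  "empirical N x = avg_measure N (\<lambda>i. return borel (x i))"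

definition probs_with_marginal ::
  "'x::topological_space measure \<Rightarrow> ('x \<times> 'y::topological_space) measure set" where
  "probs_with_marginal \<mu> = {\<gamma> \<in> borel_probs. distr \<gamma> borel fst = \<mu>}"

text \<open>Functions on \<open>{1..N}\<close> are taken extensional, so that a profile is determined by its
  entries; this matters for the definite description in \<open>profile_of\<close>.\<close>

abbreviation pure_profiles :: "nat \<Rightarrow> (nat \<Rightarrow> 'y) set" where
  "pure_profiles N \<equiv> {1..N} \<rightarrow>\<^sub>E UNIV"

abbreviation mixed_profiles :: "nat \<Rightarrow> (nat \<Rightarrow> 'y::topological_space measure) set" where
  "mixed_profiles N \<equiv> {1..N} \<rightarrow>\<^sub>E borel_probs"

definition plan_of ::
  "nat \<Rightarrow> (nat \<Rightarrow> 'x::topological_space) \<Rightarrow> (nat \<Rightarrow> 'y::topological_space measure)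
     \<Rightarrow> ('x \<times> 'y) measure" where
  "plan_of N x \<nu> = avg_measure N (\<lambda>i. return borel (x i) \<Otimes>\<^sub>M \<nu> i)"

definition pure_plan_of ::
  "nat \<Rightarrow> (nat \<Rightarrow> 'x::topological_space) \<Rightarrow> (nat \<Rightarrow> 'y::topological_space)
     \<Rightarrow> ('x \<times> 'y) measure" where
  "pure_plan_of N x y = empirical N (\<lambda>i. (x i, y i))"

definition pure_plans ::
  "nat \<Rightarrow> (nat \<Rightarrow> 'x::topological_space) \<Rightarrow> ('x \<times> 'y::topological_space) measure set" where
  "pure_plans N x = pure_plan_of N x ` pure_profiles N"

text \<open>The unique decomposition of a plan with first marginal \<open>empirical N x\<close>; it is meaningful
  only when \<open>x 1, \<dots>, x N\<close> are pairwise distinct.\<close>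

definition profile_of ::
  "nat \<Rightarrow> (nat \<Rightarrow> 'x::topological_space) \<Rightarrow> ('x \<times> 'y::topological_space) measure
     \<Rightarrow> nat \<Rightarrow> 'y measure" where
  "profile_of N x \<gamma> = (THE \<nu>. \<nu> \<in> mixed_profiles N \<and> \<gamma> = plan_of N x \<nu>)"

definition linear_cost :: "('y \<Rightarrow> ennreal) \<Rightarrow> 'y measure \<Rightarrow> ennreal" where
  "linear_cost L \<nu> = (\<integral>\<^sup>+ y. L y \<partial>\<nu>)"

definition interaction_cost ::
  "('y \<times> 'y \<Rightarrow> ennreal) \<Rightarrow> 'y measure \<Rightarrow> 'y measure \<Rightarrow> ennreal" where
  "interaction_cost H \<nu> \<nu>' = (\<integral>\<^sup>+ p. H p \<partial>(\<nu> \<Otimes>\<^sub>M \<nu>'))"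

definition mixed_cost ::
  "('x::topological_space \<times> 'y::topological_space \<Rightarrow> ennreal) \<Rightarrow> ('y \<Rightarrow> ennreal)
     \<Rightarrow> ('y \<times> 'y \<Rightarrow> ennreal) \<Rightarrow> nat \<Rightarrow> (nat \<Rightarrow> 'x) \<Rightarrow> ('x \<times> 'y) measure \<Rightarrow> ennreal" where
  "mixed_cost c L H N x \<gamma> =
     (if \<gamma> \<in> probs_with_marginal (empirical N x) then
        (let \<nu> = profile_of N x \<gamma> in
           (\<integral>\<^sup>+ p. c p \<partial>\<gamma>)
           + (\<Sum>i\<in>{1..N}. linear_cost L (\<nu> i)) / of_nat N
           + (\<Sum>i\<in>{1..N}. \<Sum>j\<in>{1..N} - {i}. interaction_cost H (\<nu> i) (\<nu> j)) / (of_nat N)\<^sup>2)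
      else \<infinity>)"

definition pure_cost ::
  "('x::topological_space \<times> 'y::topological_space \<Rightarrow> ennreal) \<Rightarrow> ('y \<Rightarrow> ennreal)
     \<Rightarrow> ('y \<times> 'y \<Rightarrow> ennreal) \<Rightarrow> nat \<Rightarrow> (nat \<Rightarrow> 'x) \<Rightarrow> (nat \<Rightarrow> 'y) \<Rightarrow> ennreal" where
  "pure_cost c L H N x y = mixed_cost c L H N x (pure_plan_of N x y)"

text \<open>The cost of player \<open>i\<close> when playing \<open>\<rho>\<close> against \<open>\<nu> j\<close>, \<open>j \<noteq> i\<close>; the entry \<open>\<nu> i\<close> is not used.\<close>

definition player_cost ::
  "('x \<times> 'y \<Rightarrow> ennreal) \<Rightarrow> ('y \<Rightarrow> ennreal) \<Rightarrow> ('y \<times> 'y \<Rightarrow> ennreal)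
     \<Rightarrow> nat \<Rightarrow> (nat \<Rightarrow> 'x) \<Rightarrow> nat \<Rightarrow> 'y measure \<Rightarrow> (nat \<Rightarrow> 'y measure) \<Rightarrow> ennreal" where
  "player_cost c L H N x i \<rho> \<nu> =
     (\<integral>\<^sup>+ y. c (x i, y) \<partial>\<rho>) + linear_cost L \<rho>
     + (2 / of_nat N) * (\<Sum>j\<in>{1..N} - {i}. interaction_cost H \<rho> (\<nu> j))"

definition nash_equilibrium ::
  "('x \<times> 'y::topological_space \<Rightarrow> ennreal) \<Rightarrow> ('y \<Rightarrow> ennreal) \<Rightarrow> ('y \<times> 'y \<Rightarrow> ennreal)
     \<Rightarrow> nat \<Rightarrow> (nat \<Rightarrow> 'x) \<Rightarrow> (nat \<Rightarrow> 'y measure) \<Rightarrow> bool" where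
  "nash_equilibrium c L H N x \<nu> \<longleftrightarrow>
     (\<forall>i\<in>{1..N}. \<nu> i \<in> borel_probs \<and>
       (\<forall>\<rho>\<in>borel_probs. player_cost c L H N x i (\<nu> i) \<nu> \<le> player_cost c L H N x i \<rho> \<nu>))"

end

theory Submission
  imports Defs
begin

text \<open>
Everything rests on one identity.  An i.i.d. sample of an atomless law has pairwise distinct
entries almost surely (\<open>AE_iid_atomless_distinct\<close>), and for such a sample \<open>x\<close> the plans with
first marginal \<open>empirical N x\<close> correspond bijectively to mixed profiles \<open>\<nu>\<close>
(\<open>inj_on_plan_of\<close>, \<open>plan_of_surj\<close>).  In terms of \<open>\<nu>\<close> the cost of a plan is a sum of integrals
against \<open>\<nu> i\<close> and \<open>\<nu> i \<otimes> \<nu> j\<close> with \<open>i \<noteq> j\<close>; the self-interaction is absent, so all of these measures are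
marginals of the product \<open>\<nu> 1 \<otimes> \<dots> \<otimes> \<nu> N\<close>, and the mixed cost is the expectation of
the pure cost under this product (\<open>profile_cost_eq_expectation\<close>).

An expectation is at least the minimum of the integrand, with equality exactly when the
integrand is almost surely equal to its minimum (\<open>nn_integral_eq_lower_bound_iff\<close>).  As pure plans
realize pure costs, the two problems have the same value, and a plan is optimal if and only if
its product measure is concentrated on the optimal action profiles.  The minimum over action
profiles is attained by the direct method: the cost is lower semicontinuous, and its finite sublevels
lie in products of compact sublevels of \<open>L\<close> (\<open>optimal_actions_exist\<close>).

For the equilibrium property, the game is a potential game: as \<open>H\<close> is symmetric, the
interactions in which player \<open>i\<close> takes part occur twice in the double sum, so \<open>N\<close> times the mixed cost is the
individual cost of player \<open>i\<close> plus a term that depends only on the other players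
(\<open>player_cost_plus_others_cost\<close>).  When the minimum is finite this term cancels, and a minimizer
admits no profitable unilateral deviation.
\<close>

section \<open>Extended nonnegative real arithmetic\<close>

text \<open>
The first two alternatives cover the boundary cases \<open>b = 0\<close> and \<open>a = 0\<close>, where one summand has no
strictly smaller value, and the case of an infinite summand.
\<close>

lemma less_add_ennrealE:
  fixes a b t :: ennreal
  assumes "t < a + b"
  obtains "t < a" | "t < b" | u v where "u < a" "v < b" "t < u + v"
proof (cases "t < a \<or> t < b")
  case True
  then show ?thesis using that by blast
next
  case False
  then have le: "a \<le> t" "b \<le> t" by auto
  have fin: "t < \<top>"
    using assms top_greatest order_less_le_trans by blast
  then have fin': "a < \<top>" "b < \<top>"
    using le order_le_less_trans by blast+
  obtain t' a' b' where eq: "t = ennreal t'" "a = ennreal a'" "b = ennreal b'"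
    and nonneg: "0 \<le> t'" "0 \<le> a'" "0 \<le> b'"
    using fin fin' by (metis less_top_ennreal)
  have less: "t' < a' + b'" and le': "a' \<le> t'" "b' \<le> t'"
    using assms le nonneg unfolding eq
    by (simp_all add: ennreal_less_iff flip: ennreal_plus)
  \<comment> \<open>Lowering both summands by \<open>d\<close> uses up half of the gap \<open>a' + b' - t'\<close>; it leaves them nonnegative because \<open>a'\<close> and \<open>b'\<close> are at most \<open>t'\<close>.\<close>
  define d where "d = (a' + b' - t') / 4"
  show ?thesis
  proof (rule that(3))
    show "ennreal (a' - d) < a" "ennreal (b' - d) < b"
      using less le' nonneg by (auto simp: eq d_def ennreal_less_iff)
    have "t' < (a' - d) + (b' - d)" "0 \<le> a' - d" "0 \<le> b' - d"
      using less le' nonneg by (auto simp: d_def field_simps)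
    then show "t < ennreal (a' - d) + ennreal (b' - d)"
      using nonneg by (simp add: eq ennreal_less_iff flip: ennreal_plus)
  qed
qed

lemma ennreal_of_nat_divide_self: "0 < n \<Longrightarrow> of_nat n / of_nat n = (1::ennreal)"
  by (rule ennreal_divide_self) (simp_all add: less_top[symmetric])

lemma ennreal_divide_mult_of_nat: "0 < n \<Longrightarrow> (a::ennreal) / of_nat n * of_nat n = a"
  by (simp add: ennreal_divide_times ennreal_of_nat_divide_self)

lemma ennreal_of_nat_mult_divide_square:
  fixes d :: ennreal
  assumes "0 < n"
  shows "of_nat n * (d / (of_nat n)\<^sup>2) = d / of_nat n"
proof -
  have "of_nat n * inverse ((of_nat n)\<^sup>2) = (inverse (of_nat n) :: ennreal)"
    using assms
    by (simp add: ennreal_of_nat_eq_real_of_nat ennreal_power inverse_ennreal power2_eq_square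
        field_simps flip: ennreal_mult)
  then show ?thesis
    by (simp add: divide_ennreal_def mult.left_commute)
qed

section \<open>Lower semicontinuous functions\<close>

lemma lsc_iff_open: "lsc f \<longleftrightarrow> (\<forall>t. open {x. t < f x})"
proof
  assume f: "lsc f"
  show "\<forall>t. open {x. t < f x}"
  proof
    fix t
    show "open {x. t < f x}"
      using f by (subst open_subopen) (force simp: lsc_def eventually_nhds)
  qed
next
  assume "\<forall>t. open {x. t < f x}"
  then show "lsc f"
    unfolding lsc_def eventually_nhds by force
qed

lemma lsc_borel_measurable: "lsc f \<Longrightarrow> f \<in> borel_measurable borel"
  by (rule borel_measurableI_greater) (auto simp: lsc_iff_open intro: borel_open)

lemma lsc_compose:
  assumes "lsc f" "continuous_on UNIV g"
  shows "lsc (\<lambda>x. f (g x))"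
proof -
  have "open (g -` {y. t < f y})" for t
    using assms by (intro open_vimage) (auto simp: lsc_iff_open)
  then show ?thesis
    by (simp add: lsc_iff_open vimage_def)
qed

lemma lsc_add:
  assumes f: "lsc f" and g: "lsc g"
  shows "lsc (\<lambda>x. f x + g x)"
  unfolding lsc_def
proof (intro allI impI)
  fix x t assume "t < f x + g x"
  then show "\<forall>\<^sub>F z in nhds x. t < f z + g z"
  proof (cases rule: less_add_ennrealE)
    case 1
    with f have "\<forall>\<^sub>F z in nhds x. t < f z" by (simp add: lsc_def)
    then show ?thesis
      by (rule eventually_mono) (metis add.right_neutral add_left_mono order_less_le_trans zero_le)
  next
    case 2
    with g have "\<forall>\<^sub>F z in nhds x. t < g z" by (simp add: lsc_def)
    then show ?thesis
      by (rule eventually_mono) (metis add.left_neutral add_right_mono order_less_le_trans zero_le)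
  next
    case (3 u v)
    with f g have "\<forall>\<^sub>F z in nhds x. u < f z" "\<forall>\<^sub>F z in nhds x. v < g z"
      by (simp_all add: lsc_def)
    then show ?thesis
      by eventually_elim (metis \<open>t < u + v\<close> add_mono less_imp_le order_less_le_trans)
  qed
qed

lemma lsc_const: "lsc (\<lambda>_. a)"
  by (simp add: lsc_def)

lemma lsc_sum: "(\<And>i. i \<in> I \<Longrightarrow> lsc (f i)) \<Longrightarrow> lsc (\<lambda>x. \<Sum>i\<in>I. f i x)"
  by (induction I rule: infinite_finite_induct) (simp_all add: lsc_const lsc_add)

lemma lsc_divide:
  assumes f: "lsc f" and b: "0 < b" "b < \<top>"
  shows "lsc (\<lambda>x. f x / b)"
proof -
  have *: "f x / b \<le> t \<longleftrightarrow> f x \<le> t * b" for t x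
  proof
    assume "f x / b \<le> t"
    then have "f x / b * b \<le> t * b" by (rule mult_right_mono) simp
    then show "f x \<le> t * b" using b by (simp add: ennreal_divide_times)
  next
    assume "f x \<le> t * b"
    then have "f x / b \<le> t * b / b" by (rule divide_right_mono_ennreal)
    then show "f x / b \<le> t" using b by (simp add: mult_divide_eq_ennreal)
  qed
  have "t < f x / b \<longleftrightarrow> t * b < f x" for t x
    using *[of x t] by (simp flip: not_le)
  with f show ?thesis
    by (simp add: lsc_iff_open)
qed

text \<open>
If no point of \<open>K\<close> were minimal, the open sets on which \<open>f\<close> exceeds its value at a point of \<open>K\<close> would
cover \<open>K\<close>; the best of the finitely many points of a subcover lies in none of its sets.
\<close>

lemma lsc_attains_min_on_compact:
  assumes f: "lsc f" and K: "compact K" "K \<noteq> {}"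
  obtains x where "x \<in> K" "\<And>y. y \<in> K \<Longrightarrow> f x \<le> f y"
proof (rule ccontr)
  assume neg: "\<not> thesis"
  have "K \<subseteq> (\<Union>x\<in>K. {z. f x < f z})"
    using neg that by (force simp: not_le)
  moreover have "open {z. f x < f z}" for x
    using f by (simp add: lsc_iff_open)
  ultimately obtain D where D: "D \<subseteq> K" "finite D" "K \<subseteq> (\<Union>x\<in>D. {z. f x < f z})"
    by (metis compactE_image[OF K(1), of K "\<lambda>x. {z. f x < f z}"])
  with K(2) have "D \<noteq> {}" by auto
  with D(2) obtain x where x: "x \<in> D" "\<And>y. y \<in> D \<Longrightarrow> f x \<le> f y"
    using ex_is_arg_min_if_finite[of D f] by (auto simp: is_arg_min_linorder)
  then obtain y where "y \<in> D" "f y < f x"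
    using D by blast
  with x show False
    by (simp add: leD)
qed

section \<open>Plans and mixed profiles\<close>

lemma emeasure_empirical:
  "A \<in> sets borel \<Longrightarrow> emeasure (empirical N x) A = (\<Sum>i\<in>{1..N}. indicator A (x i)) / of_nat N"
  unfolding empirical_def by (subst emeasure_avg_measure) simp_all

lemma nn_integral_avg_measure:
  fixes \<kappa> :: "nat \<Rightarrow> 'a::topological_space measure"
  assumes s: "\<And>i. i \<in> {1..N} \<Longrightarrow> sets (\<kappa> i) = sets borel"
    and f: "f \<in> borel_measurable borel"
  shows "(\<integral>\<^sup>+ z. f z \<partial>avg_measure N \<kappa>) = (\<Sum>i\<in>{1..N}. \<integral>\<^sup>+ z. f z \<partial>\<kappa> i) / of_nat N"
proof -
  have meas: "g \<in> borel_measurable (\<kappa> i)" "g \<in> borel_measurable (avg_measure N \<kappa>)"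
    if "g \<in> borel_measurable borel" "i \<in> {1..N}" for g :: "'a \<Rightarrow> ennreal" and i
    using that s[of i] by (simp_all cong: measurable_cong_sets)
  show ?thesis
    using f
  proof (induction rule: borel_measurable_induct)
    case (cong f g)
    then show ?case by (simp add: fun_eq_iff)
  next
    case (set A)
    then have "(\<integral>\<^sup>+ z. indicator A z \<partial>\<kappa> i) = emeasure (\<kappa> i) A" if "i \<in> {1..N}" for i
      using s[OF that] by (simp add: nn_integral_indicator)
    then have "(\<Sum>i\<in>{1..N}. \<integral>\<^sup>+ z. indicator A z \<partial>\<kappa> i) = (\<Sum>i\<in>{1..N}. emeasure (\<kappa> i) A)"
      by (rule sum.cong[OF refl])
    moreover have "(\<integral>\<^sup>+ z. indicator A z \<partial>avg_measure N \<kappa>) = emeasure (avg_measure N \<kappa>) A"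
      using set by (intro nn_integral_indicator) simp
    ultimately show ?case
      using emeasure_avg_measure[OF s set] by simp
  next
    case (mult u a)
    have "(\<integral>\<^sup>+ z. a * u z \<partial>avg_measure N \<kappa>) = a * (\<integral>\<^sup>+ z. u z \<partial>avg_measure N \<kappa>)"
      using mult by (intro nn_integral_cmult) (simp cong: measurable_cong_sets)
    moreover have "(\<integral>\<^sup>+ z. a * u z \<partial>\<kappa> i) = a * (\<integral>\<^sup>+ z. u z \<partial>\<kappa> i)" if "i \<in> {1..N}" for i
      using mult that by (intro nn_integral_cmult meas)
    ultimately show ?case
      using mult by (simp add: sum_distrib_left[symmetric] divide_ennreal_def mult.assoc)
  next
    case (add u v)
    have "(\<integral>\<^sup>+ z. v z + u z \<partial>avg_measure N \<kappa>)
        = (\<integral>\<^sup>+ z. v z \<partial>avg_measure N \<kappa>) + (\<integral>\<^sup>+ z. u z \<partial>avg_measure N \<kappa>)"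
      using add by (intro nn_integral_add) (simp_all cong: measurable_cong_sets)
    moreover have "(\<integral>\<^sup>+ z. v z + u z \<partial>\<kappa> i) = (\<integral>\<^sup>+ z. v z \<partial>\<kappa> i) + (\<integral>\<^sup>+ z. u z \<partial>\<kappa> i)"
      if "i \<in> {1..N}" for i
      using add that by (intro nn_integral_add meas)
    ultimately show ?case
      using add by (simp add: sum.distrib divide_ennreal_def distrib_right)
  next
    case (seq U)
    have "(\<integral>\<^sup>+ z. (SUP n. U n z) \<partial>avg_measure N \<kappa>) = (SUP n. \<integral>\<^sup>+ z. U n z \<partial>avg_measure N \<kappa>)"
      using seq by (intro nn_integral_monotone_convergence_SUP) (simp_all cong: measurable_cong_sets)
    also have "\<dots> = (SUP n. (\<Sum>i\<in>{1..N}. \<integral>\<^sup>+ z. U n z \<partial>\<kappa> i)) / of_nat N"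
      using seq by (simp add: divide_ennreal_def SUP_mult_right_ennreal)
    also have "(SUP n. (\<Sum>i\<in>{1..N}. \<integral>\<^sup>+ z. U n z \<partial>\<kappa> i)) = (\<Sum>i\<in>{1..N}. SUP n. \<integral>\<^sup>+ z. U n z \<partial>\<kappa> i)"
      using seq(3) by (intro incseq_sumI2 ennreal_SUP_sum)
        (auto simp: incseq_def le_fun_def intro!: nn_integral_mono)
    also have "\<dots> = (\<Sum>i\<in>{1..N}. \<integral>\<^sup>+ z. (SUP n. U n z) \<partial>\<kappa> i)"
      using seq by (intro sum.cong refl nn_integral_monotone_convergence_SUP[symmetric] meas) auto
    finally show ?case by (simp add: image_comp)
  qed
qed

lemma sets_mixed_profiles: "\<nu> \<in> mixed_profiles N \<Longrightarrow> i \<in> {1..N} \<Longrightarrow> sets (\<nu> i) = sets borel"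
  by (auto simp: space_prob_algebra PiE_iff)

lemma prob_space_mixed_profiles: "\<nu> \<in> mixed_profiles N \<Longrightarrow> i \<in> {1..N} \<Longrightarrow> prob_space (\<nu> i)"
  by (auto simp: space_prob_algebra PiE_iff)

context
  fixes N :: nat
    and x :: "nat \<Rightarrow> 'x::{second_countable_topology,t1_space}"
begin

lemma sets_plan_of [simp]: "sets (plan_of N x \<nu>) = sets borel"
  by (simp add: plan_of_def)

lemma sets_return_pair:
  fixes \<nu> :: "nat \<Rightarrow> 'y::second_countable_topology measure"
  assumes "\<nu> \<in> mixed_profiles N" "i \<in> {1..N}"
  shows "sets (return borel (x i) \<Otimes>\<^sub>M \<nu> i) = sets borel"
  unfolding borel_prod[symmetric]
  by (intro sets_pair_measure_cong) (simp_all add: sets_mixed_profiles[OF assms])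

lemma nn_integral_plan_of:
  fixes \<nu> :: "nat \<Rightarrow> 'y::second_countable_topology measure"
  assumes \<nu>: "\<nu> \<in> mixed_profiles N" and f: "f \<in> borel_measurable borel"
  shows "(\<integral>\<^sup>+ p. f p \<partial>plan_of N x \<nu>) = (\<Sum>i\<in>{1..N}. \<integral>\<^sup>+ y. f (x i, y) \<partial>\<nu> i) / of_nat N"
proof -
  have "(\<integral>\<^sup>+ p. f p \<partial>(return borel (x i) \<Otimes>\<^sub>M \<nu> i)) = (\<integral>\<^sup>+ y. f (x i, y) \<partial>\<nu> i)" if i: "i \<in> {1..N}" for i
  proof -
    interpret prob_space "\<nu> i"
      by (rule prob_space_mixed_profiles[OF \<nu> i])
    have f': "f \<in> borel_measurable (return borel (x i) \<Otimes>\<^sub>M \<nu> i)"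
      using f sets_return_pair[OF \<nu> i] by (simp cong: measurable_cong_sets)
    have f'': "f \<in> borel_measurable (borel \<Otimes>\<^sub>M \<nu> i)"
      using f' by (simp cong: measurable_cong_sets)
    show ?thesis
      using borel_measurable_nn_integral_fst[OF f'']
      by (simp add: nn_integral_fst[OF f', symmetric] nn_integral_return)
  qed
  then show ?thesis
    unfolding plan_of_def using sets_return_pair[OF \<nu>] f
    by (subst nn_integral_avg_measure) simp_all
qed

lemma emeasure_plan_of:
  fixes \<nu> :: "nat \<Rightarrow> 'y::second_countable_topology measure"
  assumes \<nu>: "\<nu> \<in> mixed_profiles N" and A: "A \<in> sets borel"
  shows "emeasure (plan_of N x \<nu>) A
    = (\<Sum>i\<in>{1..N}. emeasure (\<nu> i) (Pair (x i) -` A)) / of_nat N"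
proof -
  have "(\<integral>\<^sup>+ y. indicator A (x i, y) \<partial>\<nu> i) = emeasure (\<nu> i) (Pair (x i) -` A)" if "i \<in> {1..N}" for i
  proof -
    have "Pair (x i) -` A \<in> sets (\<nu> i)"
      using A by (simp add: sets_mixed_profiles[OF \<nu> that] borel_prod[symmetric] sets_Pair1)
    then show ?thesis
      by (simp flip: nn_integral_indicator) (simp add: indicator_def)
  qed
  then show ?thesis
    using nn_integral_plan_of[OF \<nu>, of "indicator A"] A by simp
qed

context
  assumes N_pos: "0 < N"
begin

lemma plan_of_has_marginal:
  fixes \<nu> :: "nat \<Rightarrow> 'y::second_countable_topology measure"
  assumes \<nu>: "\<nu> \<in> mixed_profiles N"
  shows "plan_of N x \<nu> \<in> probs_with_marginal (empirical N x)"
proof -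
  have total: "emeasure (\<nu> i) UNIV = 1" if "i \<in> {1..N}" for i
    using prob_space.emeasure_space_1[OF prob_space_mixed_profiles[OF \<nu> that]]
      sets_eq_imp_space_eq[OF sets_mixed_profiles[OF \<nu> that]] by simp
  have "emeasure (plan_of N x \<nu>) UNIV = of_nat N / of_nat N"
    using total by (simp add: emeasure_plan_of[OF \<nu>])
  then have "prob_space (plan_of N x \<nu>)"
    using N_pos by (intro prob_spaceI)
      (simp add: sets_eq_imp_space_eq[OF sets_plan_of] ennreal_of_nat_divide_self)
  moreover have "distr (plan_of N x \<nu>) borel fst = empirical N x"
  proof (rule measure_eqI)
    show "sets (distr (plan_of N x \<nu>) borel fst) = sets (empirical N x)"
      by (simp add: empirical_def)
    fix A assume "A \<in> sets (distr (plan_of N x \<nu>) borel fst)"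
    then have A: "A \<in> sets borel" by simp
    have fst: "fst \<in> borel_measurable (borel :: ('x \<times> 'y) measure)"
      by (simp add: borel_measurable_continuous_onI continuous_on_fst)
    then have "fst \<in> borel_measurable (plan_of N x \<nu>)"
      by (simp cong: measurable_cong_sets)
    then have "emeasure (distr (plan_of N x \<nu>) borel fst) A = emeasure (plan_of N x \<nu>) (fst -` A)"
      using A by (simp add: emeasure_distr sets_eq_imp_space_eq[OF sets_plan_of])
    also have "\<dots> = (\<Sum>i\<in>{1..N}. emeasure (\<nu> i) (Pair (x i) -` fst -` A)) / of_nat N"
      using measurable_sets[OF fst A] by (intro emeasure_plan_of \<nu>) simp
    also have "(\<Sum>i\<in>{1..N}. emeasure (\<nu> i) (Pair (x i) -` fst -` A))
        = (\<Sum>i\<in>{1..N}. indicator A (x i))"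
    proof (intro sum.cong refl)
      fix i assume "i \<in> {1..N}"
      then show "emeasure (\<nu> i) (Pair (x i) -` fst -` A) = indicator A (x i)"
        by (cases "x i \<in> A") (simp_all add: vimage_def total)
    qed
    finally show "emeasure (distr (plan_of N x \<nu>) borel fst) A = emeasure (empirical N x) A"
      using A by (simp add: emeasure_empirical)
  qed
  ultimately show ?thesis
    by (simp add: probs_with_marginal_def space_prob_algebra)
qed

lemma pure_plan_of_eq_plan_of:
  fixes y :: "nat \<Rightarrow> 'y::second_countable_topology"
  shows "pure_plan_of N x y = plan_of N x (\<lambda>i\<in>{1..N}. return borel (y i))"
proof (rule measure_eqI)
  show "sets (pure_plan_of N x y) = sets (plan_of N x (\<lambda>i\<in>{1..N}. return borel (y i)))"
    by (simp add: pure_plan_of_def empirical_def)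
  fix A assume "A \<in> sets (pure_plan_of N x y)"
  then have A: "A \<in> sets borel" by (simp add: pure_plan_of_def empirical_def)
  have "Pair a -` A \<in> sets borel" for a
    using A by (simp add: borel_prod[symmetric] sets_Pair1)
  moreover have "(\<lambda>i\<in>{1..N}. return borel (y i)) \<in> mixed_profiles N"
    by (auto simp: space_prob_algebra prob_space_return)
  ultimately show "emeasure (pure_plan_of N x y) A
      = emeasure (plan_of N x (\<lambda>i\<in>{1..N}. return borel (y i))) A"
    using A by (simp add: pure_plan_of_def emeasure_empirical emeasure_plan_of indicator_def)
qed

context
  assumes distinct: "inj_on x {1..N}"
begin

text \<open>
Distinctness enters here: the vertical line over \<open>x i\<close> meets only the \<open>i\<close>-th summand of the plan, so
each strategy \<open>\<nu> i\<close> can be read off from the plan.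
\<close>

lemma emeasure_plan_of_section:
  fixes \<nu> :: "nat \<Rightarrow> 'y::second_countable_topology measure"
  assumes \<nu>: "\<nu> \<in> mixed_profiles N" and i: "i \<in> {1..N}" and B: "B \<in> sets borel"
  shows "emeasure (plan_of N x \<nu>) ({x i} \<times> B) * of_nat N = emeasure (\<nu> i) B"
proof -
  have "{x i} \<times> B \<in> sets borel"
    using B by (simp add: borel_prod[symmetric])
  then have "emeasure (plan_of N x \<nu>) ({x i} \<times> B)
      = (\<Sum>j\<in>{1..N}. emeasure (\<nu> j) (Pair (x j) -` ({x i} \<times> B))) / of_nat N"
    by (rule emeasure_plan_of[OF \<nu>])
  also have "(\<Sum>j\<in>{1..N}. emeasure (\<nu> j) (Pair (x j) -` ({x i} \<times> B)))
      = (\<Sum>j\<in>{1..N}. if j = i then emeasure (\<nu> i) B else 0)"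
  proof (intro sum.cong refl)
    fix j assume "j \<in> {1..N}"
    then have "x j = x i \<longleftrightarrow> j = i"
      using distinct i by (auto dest: inj_onD)
    then show "emeasure (\<nu> j) (Pair (x j) -` ({x i} \<times> B)) = (if j = i then emeasure (\<nu> i) B else 0)"
      by (simp add: vimage_def)
  qed
  finally show ?thesis
    using i N_pos by (simp add: sum.delta ennreal_divide_mult_of_nat)
qed

lemma inj_on_plan_of:
  "inj_on (plan_of N x) (mixed_profiles N :: (nat \<Rightarrow> 'y::second_countable_topology measure) set)"
proof (rule inj_onI)
  fix \<nu> \<nu>' :: "nat \<Rightarrow> 'y measure"
  assume \<nu>: "\<nu> \<in> mixed_profiles N" and \<nu>': "\<nu>' \<in> mixed_profiles N"
    and eq: "plan_of N x \<nu> = plan_of N x \<nu>'"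
  have "\<nu> i = \<nu>' i" if i: "i \<in> {1..N}" for i
  proof (rule measure_eqI)
    show "sets (\<nu> i) = sets (\<nu>' i)"
      using i by (simp add: sets_mixed_profiles[OF \<nu>] sets_mixed_profiles[OF \<nu>'])
    fix B assume "B \<in> sets (\<nu> i)"
    then have "B \<in> sets borel"
      using i by (simp add: sets_mixed_profiles[OF \<nu>])
    then show "emeasure (\<nu> i) B = emeasure (\<nu>' i) B"
      using emeasure_plan_of_section[OF \<nu> i] emeasure_plan_of_section[OF \<nu>' i] eq by metis
  qed
  then show "\<nu> = \<nu>'"
    using \<nu> \<nu>' by (intro PiE_ext)
qed

lemma profile_of_plan_of:
  fixes \<nu> :: "nat \<Rightarrow> 'y::second_countable_topology measure"
  assumes "\<nu> \<in> mixed_profiles N"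
  shows "profile_of N x (plan_of N x \<nu>) = \<nu>"
  unfolding profile_of_def using assms inj_on_plan_of
  by (intro the_equality) (auto dest: inj_onD)

lemma emeasure_empirical_atom:
  assumes "i \<in> {1..N}"
  shows "emeasure (empirical N x) {x i} * of_nat N = 1"
proof -
  have "(\<Sum>j\<in>{1..N}. indicator {x i} (x j)) = (\<Sum>j\<in>{1..N}. if j = i then 1 else 0 :: ennreal)"
    using assms distinct by (intro sum.cong) (auto simp: indicator_def dest: inj_onD)
  then show ?thesis
    using assms N_pos by (simp add: emeasure_empirical ennreal_divide_mult_of_nat)
qed

text \<open>
Over a finite set of atoms no general disintegration theorem is called for: the conditional law
above \<open>x i\<close> is the restriction of the plan to a vertical line, scaled by \<open>N\<close>.
\<close>

lemma plan_of_surj: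
  fixes \<gamma> :: "('x \<times> 'y::second_countable_topology) measure"
  assumes \<gamma>: "\<gamma> \<in> probs_with_marginal (empirical N x)"
  obtains \<nu> where "\<nu> \<in> mixed_profiles N" "\<gamma> = plan_of N x \<nu>"
proof -
  have sets: "sets \<gamma> = sets borel" and prob: "prob_space \<gamma>"
    and marg: "distr \<gamma> borel fst = empirical N x"
    using \<gamma> by (simp_all add: probs_with_marginal_def space_prob_algebra)
  note space = sets_eq_imp_space_eq[OF sets]
  have meas: "fst \<in> borel_measurable \<gamma>" "snd \<in> borel_measurable \<gamma>"
    using sets by (simp_all add: borel_measurable_continuous_onI continuous_on_fst continuous_on_snd
        cong: measurable_cong_sets)
  have cylinder: "emeasure \<gamma> (C \<times> UNIV) = emeasure (empirical N x) C" if "C \<in> sets borel" for C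
  proof -
    have "emeasure (distr \<gamma> borel fst) C = emeasure \<gamma> (C \<times> UNIV)"
      using meas that by (auto simp: emeasure_distr space intro!: arg_cong[where f = "emeasure \<gamma>"])
    then show ?thesis by (simp add: marg)
  qed
  have slab: "{x i} \<times> B \<in> sets \<gamma>" if "B \<in> sets borel" for B :: "'y set" and i
    using that by (simp add: sets borel_prod[symmetric])
  define \<nu> where "\<nu> = (\<lambda>i\<in>{1..N}.
    distr (density \<gamma> (\<lambda>p. of_nat N * indicator ({x i} \<times> UNIV) p)) borel snd)"
  have \<nu>_emeasure: "emeasure (\<nu> i) B = of_nat N * emeasure \<gamma> ({x i} \<times> B)"
    if i: "i \<in> {1..N}" and B: "B \<in> sets borel" for i B
  proof -
    have "emeasure (\<nu> i) B = emeasure (density \<gamma> (\<lambda>p. of_nat N * indicator ({x i} \<times> UNIV) p)) (snd -` B)"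
      using i B meas by (simp add: \<nu>_def emeasure_distr space)
    also have "\<dots> = (\<integral>\<^sup>+ p. of_nat N * indicator ({x i} \<times> UNIV) p * indicator (snd -` B) p \<partial>\<gamma>)"
      using slab[of UNIV i] measurable_sets[OF meas(2) B]
      by (intro emeasure_density) (simp_all add: space)
    also have "\<dots> = (\<integral>\<^sup>+ p. of_nat N * indicator ({x i} \<times> B) p \<partial>\<gamma>)"
      by (intro nn_integral_cong) (auto simp: indicator_def)
    also have "\<dots> = of_nat N * emeasure \<gamma> ({x i} \<times> B)"
      using slab[OF B, of i] by (rule nn_integral_cmult_indicator)
    finally show ?thesis .
  qed
  have \<nu>: "\<nu> \<in> mixed_profiles N"
  proof (rule PiE_I)
    fix i assume i: "i \<in> {1..N}"
    have "emeasure (\<nu> i) UNIV = 1"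
      using emeasure_empirical_atom[OF i] by (simp add: \<nu>_emeasure[OF i] cylinder mult.commute)
    moreover have "sets (\<nu> i) = sets borel"
      using i by (simp add: \<nu>_def)
    ultimately show "\<nu> i \<in> borel_probs"
      by (auto simp: space_prob_algebra dest: sets_eq_imp_space_eq intro!: prob_spaceI)
  qed (auto simp: \<nu>_def)
  have carrier: "x ` {1..N} \<times> UNIV \<in> sets \<gamma>"
    by (simp add: sets borel_prod[symmetric] borel_closed finite_imp_closed)
  have "emeasure \<gamma> (x ` {1..N} \<times> UNIV) = 1"
    using N_pos by (simp add: cylinder emeasure_empirical borel_closed finite_imp_closed ennreal_of_nat_divide_self)
  \<comment> \<open>The first marginal is carried by \<open>x ` {1..N}\<close>, so the finitely many vertical lines exhaust the plan.\<close>
  then have conc: "AE p in \<gamma>. p \<in> x ` {1..N} \<times> UNIV"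
    using prob_space.emeasure_eq_1_AE[OF prob] carrier by (simp add: prob_space.AE_in_set_eq_1[OF prob] measure_def)
  have "\<gamma> = plan_of N x \<nu>"
  proof (rule measure_eqI)
    show "sets \<gamma> = sets (plan_of N x \<nu>)" by (simp add: sets)
    fix A assume A: "A \<in> sets \<gamma>"
    then have sec: "Pair a -` A \<in> sets borel" for a
      by (simp add: sets borel_prod[symmetric] sets_Pair1)
    have "emeasure \<gamma> A = emeasure \<gamma> (\<Union>i\<in>{1..N}. {x i} \<times> (Pair (x i) -` A))"
    proof (rule emeasure_eq_AE)
      show "AE p in \<gamma>. p \<in> A \<longleftrightarrow> p \<in> (\<Union>i\<in>{1..N}. {x i} \<times> (Pair (x i) -` A))"
        using conc by eventually_elim auto
    qed (use A slab[OF sec] in auto)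
    also have "\<dots> = (\<Sum>i\<in>{1..N}. emeasure \<gamma> ({x i} \<times> (Pair (x i) -` A)))"
      using slab[OF sec] distinct
      by (intro sum_emeasure[symmetric]) (auto simp: disjoint_family_on_def dest: inj_onD)
    also have "\<dots> = (\<Sum>i\<in>{1..N}. emeasure (\<nu> i) (Pair (x i) -` A)) / of_nat N"
      using N_pos \<nu>_emeasure[OF _ sec]
      by (simp add: sum_distrib_right[symmetric] mult.commute[of "of_nat N"] mult_divide_eq_ennreal)
    also have "\<dots> = emeasure (plan_of N x \<nu>) A"
      using A by (simp add: emeasure_plan_of[OF \<nu>] sets)
    finally show "emeasure \<gamma> A = emeasure (plan_of N x \<nu>) A" .
  qed
  with \<nu> that show ?thesis by blast
qed

end

end

end

section \<open>Two-dimensional marginals of product measures\<close>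

lemma distr_PiM_pair:
  assumes M: "\<And>i. i \<in> I \<Longrightarrow> prob_space (M i)"
    and ij: "i \<in> I" "j \<in> I" "i \<noteq> j"
  shows "distr (PiM I M) (M i \<Otimes>\<^sub>M M j) (\<lambda>\<omega>. (\<omega> i, \<omega> j)) = M i \<Otimes>\<^sub>M M j"
proof (rule pair_measure_eqI[symmetric])
  show "sigma_finite_measure (M i)" "sigma_finite_measure (M j)"
    using M ij by (simp_all add: prob_space_imp_sigma_finite)
  fix A B assume AB: "A \<in> sets (M i)" "B \<in> sets (M j)"
  have "(\<lambda>\<omega>. (\<omega> i, \<omega> j)) -` (A \<times> B) \<inter> space (PiM I M)
      = prod_emb I M {i, j} (\<Pi>\<^sub>E k\<in>{i, j}. if k = i then A else B)"
    using ij by (auto simp: prod_emb_def space_PiM PiE_iff)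
  then have "emeasure (distr (PiM I M) (M i \<Otimes>\<^sub>M M j) (\<lambda>\<omega>. (\<omega> i, \<omega> j))) (A \<times> B)
      = emeasure (PiM I M) (prod_emb I M {i, j} (\<Pi>\<^sub>E k\<in>{i, j}. if k = i then A else B))"
    using ij AB by (subst emeasure_distr) auto
  also have "\<dots> = (\<Prod>k\<in>{i, j}. emeasure (M k) (if k = i then A else B))"
    using ij AB by (intro emeasure_PiM_emb M) auto
  also have "\<dots> = emeasure (M i) A * emeasure (M j) B"
    using ij by simp
  finally show "emeasure (M i) A * emeasure (M j) B
      = emeasure (distr (PiM I M) (M i \<Otimes>\<^sub>M M j) (\<lambda>\<omega>. (\<omega> i, \<omega> j))) (A \<times> B)" ..
qed simp

lemma nn_integral_PiM_component:
  assumes M: "\<And>i. i \<in> I \<Longrightarrow> prob_space (M i)" and i: "i \<in> I"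
    and f: "f \<in> borel_measurable (M i)"
  shows "(\<integral>\<^sup>+ \<omega>. f (\<omega> i) \<partial>PiM I M) = (\<integral>\<^sup>+ y. f y \<partial>M i)"
proof -
  have "(\<integral>\<^sup>+ y. f y \<partial>M i) = (\<integral>\<^sup>+ y. f y \<partial>distr (PiM I M) (M i) (\<lambda>\<omega>. \<omega> i))"
    using i by (subst distr_PiM_component) (simp_all add: M)
  also have "\<dots> = (\<integral>\<^sup>+ \<omega>. f (\<omega> i) \<partial>PiM I M)"
    using i f by (intro nn_integral_distr) auto
  finally show ?thesis ..
qed

lemma nn_integral_PiM_pair:
  assumes M: "\<And>i. i \<in> I \<Longrightarrow> prob_space (M i)" and ij: "i \<in> I" "j \<in> I" "i \<noteq> j"
    and f: "f \<in> borel_measurable (M i \<Otimes>\<^sub>M M j)"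
  shows "(\<integral>\<^sup>+ \<omega>. f (\<omega> i, \<omega> j) \<partial>PiM I M) = (\<integral>\<^sup>+ p. f p \<partial>(M i \<Otimes>\<^sub>M M j))"
proof -
  have "(\<integral>\<^sup>+ p. f p \<partial>(M i \<Otimes>\<^sub>M M j))
      = (\<integral>\<^sup>+ p. f p \<partial>distr (PiM I M) (M i \<Otimes>\<^sub>M M j) (\<lambda>\<omega>. (\<omega> i, \<omega> j)))"
    using ij by (subst distr_PiM_pair) (simp_all add: M)
  also have "\<dots> = (\<integral>\<^sup>+ \<omega>. f (\<omega> i, \<omega> j) \<partial>PiM I M)"
    using ij f by (intro nn_integral_distr) auto
  finally show ?thesis ..
qed

section \<open>Almost sure distinctness of an i.i.d. atomless sample\<close>

lemma atomless_singleton: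
  assumes "atomless M" "{a} \<in> sets M"
  shows "emeasure M {a} = 0"
proof (rule ccontr)
  assume "emeasure M {a} \<noteq> 0"
  then have "0 < emeasure M {a}" by (simp add: zero_less_iff_neq_zero)
  moreover have "B = {} \<or> B = {a}" if "B \<subseteq> {a}" for B
    using that by (rule subset_singletonD)
  ultimately show False
    using assms unfolding atomless_def by (metis emeasure_empty)
qed

text \<open>
By independence the pair of two entries has law \<open>\<mu> \<otimes> \<mu>\<close>, which gives the diagonal mass
\<open>\<integral>\<mu>{a} d\<mu>(a) = 0\<close>.
\<close>

lemma AE_iid_atomless_distinct:
  fixes X :: "'i \<Rightarrow> 'w \<Rightarrow> 'x::{second_countable_topology,t2_space}"
  assumes "prob_space P" and indep: "prob_space.indep_vars P (\<lambda>_. borel) X UNIV"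
    and distr: "\<And>i. distr P borel (X i) = \<mu>" and atomless: "atomless \<mu>"
    and "i \<noteq> j"
  shows "AE \<omega> in P. X i \<omega> \<noteq> X j \<omega>"
proof -
  interpret prob_space P by fact
  have rv: "random_variable borel (X k)" for k
    using indep by (simp add: indep_vars_def2)
  have sets: "sets \<mu> = sets borel"
    using distr[of i] by (metis sets_distr)
  interpret \<mu>: prob_space \<mu>
    using prob_space_distr[OF rv[of i]] by (simp add: distr)
  \<comment> \<open>Independence of the singleton blocks \<open>{i}\<close> and \<open>{j}\<close> of the family, with the blocks projected onto their entries.\<close>
  have "indep_var borel ((\<lambda>f. f i) \<circ> (\<lambda>\<omega>. restrict (\<lambda>k. X k \<omega>) {i}))
      borel ((\<lambda>f. f j) \<circ> (\<lambda>\<omega>. restrict (\<lambda>k. X k \<omega>) {j}))"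
    using \<open>i \<noteq> j\<close>
    by (intro indep_var_compose[OF indep_var_restrict[OF indep]] measurable_component_singleton) auto
  then have "indep_var borel (X i) borel (X j)"
    by (simp add: comp_def)
  then have joint: "distr P (borel \<Otimes>\<^sub>M borel) (\<lambda>\<omega>. (X i \<omega>, X j \<omega>)) = \<mu> \<Otimes>\<^sub>M \<mu>"
    by (simp add: indep_var_distribution_eq distr)
  let ?D = "{p. fst p = snd p} :: ('x \<times> 'x) set"
  have "closed ?D"
    by (intro closed_Collect_eq continuous_intros)
  moreover have "sets (\<mu> \<Otimes>\<^sub>M \<mu>) = sets borel"
    unfolding borel_prod[symmetric] by (intro sets_pair_measure_cong sets)
  ultimately have D: "?D \<in> sets (\<mu> \<Otimes>\<^sub>M \<mu>)"
    using borel_closed by blast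
  have "emeasure (\<mu> \<Otimes>\<^sub>M \<mu>) ?D = (\<integral>\<^sup>+ a. emeasure \<mu> {a} \<partial>\<mu>)"
    by (subst \<mu>.emeasure_pair_measure_alt[OF D])
      (auto intro!: nn_integral_cong arg_cong[where f = "emeasure \<mu>"])
  also have "\<dots> = 0"
    using atomless by (simp add: atomless_singleton sets)
  finally have "?D \<in> null_sets (\<mu> \<Otimes>\<^sub>M \<mu>)"
    using D by (simp add: null_sets_def)
  then have "AE p in \<mu> \<Otimes>\<^sub>M \<mu>. fst p \<noteq> snd p"
    using AE_not_in by fastforce
  then have "AE p in distr P (borel \<Otimes>\<^sub>M borel) (\<lambda>\<omega>. (X i \<omega>, X j \<omega>)). fst p \<noteq> snd p"
    unfolding joint .
  moreover have "(\<lambda>\<omega>. (X i \<omega>, X j \<omega>)) \<in> P \<rightarrow>\<^sub>M borel \<Otimes>\<^sub>M borel"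
    using rv by (intro measurable_Pair)
  ultimately show ?thesis
    using AE_distrD[of "\<lambda>\<omega>. (X i \<omega>, X j \<omega>)" P _ "\<lambda>p. fst p \<noteq> snd p"] by simp
qed

section \<open>Minima, expectations and compactness\<close>

lemma argmin_on_eq:
  assumes "\<And>z. z \<in> S \<Longrightarrow> m \<le> f z" and "s \<in> S" "f s = m"
  shows "argmin_on S f = {z \<in> S. f z = m}"
  using assms unfolding argmin_on_def is_arg_min_linorder by (metis (lifting) order_antisym)

text \<open>
For finite \<open>m\<close> the nonnegative function \<open>f - m\<close> has integral zero; for \<open>m = \<infinity>\<close> both sides
hold because \<open>f\<close> is constantly infinite.
\<close>

lemma (in prob_space) nn_integral_eq_lower_bound_iff:
  assumes f: "f \<in> borel_measurable M" and m: "\<And>z. z \<in> space M \<Longrightarrow> m \<le> f z"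
  shows "(\<integral>\<^sup>+ z. f z \<partial>M) = m \<longleftrightarrow> (AE z in M. f z = m)"
proof
  assume eq: "(\<integral>\<^sup>+ z. f z \<partial>M) = m"
  show "AE z in M. f z = m"
  proof (cases "m = \<top>")
    case True
    with m show ?thesis by (auto simp: top_unique)
  next
    case False
    have "(\<integral>\<^sup>+ z. f z - m \<partial>M) = (\<integral>\<^sup>+ z. f z \<partial>M) - (\<integral>\<^sup>+ z. m \<partial>M)"
      using f m False by (intro nn_integral_diff) (auto simp: emeasure_space_1)
    then have "(\<integral>\<^sup>+ z. f z - m \<partial>M) = 0"
      using False by (simp add: eq emeasure_space_1 diff_eq_0_iff_ennreal less_top)
    then have "AE z in M. f z - m = 0"
      using f by (subst (asm) nn_integral_0_iff_AE) auto
    then show ?thesis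
      using AE_space by eventually_elim (use m False in \<open>auto simp: diff_eq_0_iff_ennreal intro: antisym\<close>)
  qed
next
  assume "AE z in M. f z = m"
  then have "(\<integral>\<^sup>+ z. f z \<partial>M) = (\<integral>\<^sup>+ z. m \<partial>M)"
    by (rule nn_integral_cong_AE)
  then show "(\<integral>\<^sup>+ z. f z \<partial>M) = m"
    by (simp add: emeasure_space_1)
qed

text \<open>
Extensional functions are pinned to \<open>undefined\<close> off \<open>I\<close>, so the set is a full product in which the
remaining factors are one-point sets, and Tychonoff's theorem applies.
\<close>

lemma compact_extensional_PiE:
  fixes K :: "'i \<Rightarrow> 'a::topological_space set"
  assumes "\<And>i. i \<in> I \<Longrightarrow> compact (K i)"
  shows "compact (PiE I K)"
proof -
  have "PiE I K = PiE UNIV (\<lambda>i. if i \<in> I then K i else {undefined})"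
    by (auto simp: PiE_iff extensional_def split: if_splits)
  moreover have "compactin (product_topology (\<lambda>_. euclidean) UNIV)
      (PiE UNIV (\<lambda>i. if i \<in> I then K i else {undefined}))"
    using assms by (simp add: compactin_PiE)
  ultimately show ?thesis
    by (simp add: euclidean_product_topology)
qed

text \<open>
Symmetry merges row \<open>i\<close> and column \<open>i\<close> of the double sum; this produces the factor 2 in the cost of a
single player.
\<close>

lemma sum_double_off_diagonal:
  fixes h :: "'a \<Rightarrow> 'a \<Rightarrow> 'b::comm_monoid_add"
  assumes I: "finite I" "i \<in> I" and sym: "\<And>j. j \<in> I - {i} \<Longrightarrow> h j i = h i j"
  shows "(\<Sum>j\<in>I. \<Sum>k\<in>I - {j}. h j k) = (\<Sum>k\<in>I - {i}. h i k) + (\<Sum>k\<in>I - {i}. h i k)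
    + (\<Sum>j\<in>I - {i}. \<Sum>k\<in>I - {i} - {j}. h j k)"
proof -
  have "(\<Sum>k\<in>I - {j}. h j k) = h i j + (\<Sum>k\<in>I - {i} - {j}. h j k)" if j: "j \<in> I - {i}" for j
  proof -
    have "(\<Sum>k\<in>I - {j}. h j k) = h j i + (\<Sum>k\<in>I - {j} - {i}. h j k)"
      using I j by (intro sum.remove) auto
    then show ?thesis
      using sym[OF j] by (simp add: Diff_insert2[symmetric] insert_commute)
  qed
  then show ?thesis
    using I by (simp add: sum.remove[of I i "\<lambda>j. \<Sum>k\<in>I - {j}. h j k"] sum.distrib add.assoc)
qed

section \<open>The mixed cost as an expected pure cost\<close>

text \<open>
The deterministic part of the argument, for one realization \<open>x\<close> of the sample with distinct
entries.
\<close>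

locale N_player_game =
  fixes c :: "'x::{second_countable_topology,t1_space} \<times> 'y::second_countable_topology \<Rightarrow> ennreal"
    and L :: "'y \<Rightarrow> ennreal"
    and H :: "'y \<times> 'y \<Rightarrow> ennreal"
    and N :: nat
    and x :: "nat \<Rightarrow> 'x"
  assumes lsc_c: "lsc c" and lsc_L: "lsc L" and lsc_H: "lsc H"
    and H_sym: "\<And>y y'. H (y, y') = H (y', y)"
    and compact_sublevel: "\<And>\<kappa>::real. \<kappa> > 0 \<Longrightarrow> compact {y. L y \<le> ennreal \<kappa>}"
    and N_pos: "N > 0"
    and distinct: "inj_on x {1..N}"
begin

text \<open>
\<open>action_cost\<close> and \<open>profile_cost\<close> are the costs of pure and mixed profiles written without the detour through
plans (\<open>pure_cost_eq_action_cost\<close>, \<open>mixed_cost_plan_of\<close>).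
\<close>

definition action_cost :: "(nat \<Rightarrow> 'y) \<Rightarrow> ennreal" where
  "action_cost y = (\<Sum>i\<in>{1..N}. c (x i, y i)) / of_nat N + (\<Sum>i\<in>{1..N}. L (y i)) / of_nat N
     + (\<Sum>i\<in>{1..N}. \<Sum>j\<in>{1..N} - {i}. H (y i, y j)) / (of_nat N)\<^sup>2"

definition profile_cost :: "(nat \<Rightarrow> 'y measure) \<Rightarrow> ennreal" where
  "profile_cost \<nu> = (\<Sum>i\<in>{1..N}. \<integral>\<^sup>+ y. c (x i, y) \<partial>\<nu> i) / of_nat N
     + (\<Sum>i\<in>{1..N}. linear_cost L (\<nu> i)) / of_nat N
     + (\<Sum>i\<in>{1..N}. \<Sum>j\<in>{1..N} - {i}. interaction_cost H (\<nu> i) (\<nu> j)) / (of_nat N)\<^sup>2"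

lemma borel_measurable_costs:
  "c \<in> borel_measurable borel" "L \<in> borel_measurable borel" "H \<in> borel_measurable borel"
  by (simp_all add: lsc_borel_measurable lsc_c lsc_L lsc_H)

lemma borel_measurable_c_section: "(\<lambda>y. c (x i, y)) \<in> borel_measurable borel"
  by (intro lsc_borel_measurable lsc_compose[OF lsc_c] continuous_intros)

lemma mixed_cost_plan_of:
  assumes "\<nu> \<in> mixed_profiles N"
  shows "mixed_cost c L H N x (plan_of N x \<nu>) = profile_cost \<nu>"
  using plan_of_has_marginal[OF N_pos assms, of x] assms
  by (simp add: mixed_cost_def profile_cost_def profile_of_plan_of[OF N_pos distinct]
      nn_integral_plan_of borel_measurable_costs)

lemma return_profile: "(\<lambda>i\<in>{1..N}. return borel (y i)) \<in> mixed_profiles N"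
  by (auto simp: space_prob_algebra prob_space_return)

lemma interaction_cost_return: "interaction_cost H (return borel a) (return borel b) = H (a, b)"
proof -
  interpret prob_space "return borel b"
    by (simp add: prob_space_return)
  have H: "H \<in> borel_measurable (return borel a \<Otimes>\<^sub>M return borel b)"
    using borel_measurable_costs(3) sets_return_pair
    by (simp add: borel_prod[symmetric] cong: measurable_cong_sets)
  have "(\<lambda>z. H (z, b)) \<in> borel_measurable borel" "(\<lambda>z. H (z', z)) \<in> borel_measurable borel" for z'
    by (intro lsc_borel_measurable lsc_compose[OF lsc_H] continuous_intros)+
  then show ?thesis
    unfolding interaction_cost_def nn_integral_fst[OF H, symmetric]
    by (simp add: nn_integral_return)
qed

lemma pure_cost_eq_action_cost: "pure_cost c L H N x y = action_cost y"
proof -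
  have "(\<Sum>i\<in>{1..N}. \<Sum>j\<in>{1..N} - {i}. interaction_cost H ((\<lambda>i\<in>{1..N}. return borel (y i)) i)
        ((\<lambda>i\<in>{1..N}. return borel (y i)) j)) = (\<Sum>i\<in>{1..N}. \<Sum>j\<in>{1..N} - {i}. H (y i, y j))"
    by (intro sum.cong refl) (auto simp: interaction_cost_return)
  then show ?thesis
    by (simp add: pure_cost_def pure_plan_of_eq_plan_of[OF N_pos] mixed_cost_plan_of[OF return_profile]
        profile_cost_def action_cost_def linear_cost_def nn_integral_return borel_measurable_costs
        borel_measurable_c_section del: One_nat_def)
qed

lemma component_measurable:
  assumes \<nu>: "\<nu> \<in> mixed_profiles N" and i: "i \<in> {1..N}"
  shows "(\<lambda>y. y i) \<in> borel_measurable (PiM {1..N} \<nu>)"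
proof -
  have "(\<lambda>y. y i) \<in> measurable (PiM {1..N} \<nu>) (\<nu> i)"
    by (rule measurable_component_singleton[OF i])
  then show ?thesis
    by (simp add: sets_mixed_profiles[OF \<nu> i] cong: measurable_cong_sets)
qed

lemma cost_terms_measurable:
  assumes \<nu>: "\<nu> \<in> mixed_profiles N" and i: "i \<in> {1..N}" and j: "j \<in> {1..N}"
  shows "(\<lambda>y. c (x i, y i)) \<in> borel_measurable (PiM {1..N} \<nu>)"
    and "(\<lambda>y. L (y i)) \<in> borel_measurable (PiM {1..N} \<nu>)"
    and "(\<lambda>y. H (y i, y j)) \<in> borel_measurable (PiM {1..N} \<nu>)"
  by (rule measurable_compose[OF component_measurable[OF \<nu> i] borel_measurable_c_section]
      measurable_compose[OF component_measurable[OF \<nu> i] borel_measurable_costs(2)]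
      measurable_compose[OF borel_measurable_Pair[OF component_measurable[OF \<nu> i]
        component_measurable[OF \<nu> j]] borel_measurable_costs(3)])+

lemma action_cost_measurable:
  assumes "\<nu> \<in> mixed_profiles N"
  shows "action_cost \<in> borel_measurable (PiM {1..N} \<nu>)"
  unfolding action_cost_def[abs_def]
  by (intro borel_measurable_add borel_measurable_divide_ennreal borel_measurable_sum
      borel_measurable_const cost_terms_measurable[OF assms]) auto

text \<open>
Each term of the pure cost depends on one or two distinct coordinates, and the corresponding
marginals of the product measure are \<open>\<nu> i\<close> and \<open>\<nu> i \<otimes> \<nu> j\<close>.
\<close>

lemma profile_cost_eq_expectation:
  assumes \<nu>: "\<nu> \<in> mixed_profiles N"
  shows "profile_cost \<nu> = (\<integral>\<^sup>+ y. action_cost y \<partial>PiM {1..N} \<nu>)"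
proof -
  note prob = prob_space_mixed_profiles[OF \<nu>]
  have c_int: "(\<integral>\<^sup>+ y. c (x i, y i) \<partial>PiM {1..N} \<nu>) = (\<integral>\<^sup>+ z. c (x i, z) \<partial>\<nu> i)"
    and L_int: "(\<integral>\<^sup>+ y. L (y i) \<partial>PiM {1..N} \<nu>) = linear_cost L (\<nu> i)" if i: "i \<in> {1..N}" for i
  proof -
    have "(\<lambda>z. c (x i, z)) \<in> borel_measurable (\<nu> i)" "L \<in> borel_measurable (\<nu> i)"
      using borel_measurable_c_section borel_measurable_costs sets_mixed_profiles[OF \<nu> i]
      by (simp_all cong: measurable_cong_sets)
    then show "(\<integral>\<^sup>+ y. c (x i, y i) \<partial>PiM {1..N} \<nu>) = (\<integral>\<^sup>+ z. c (x i, z) \<partial>\<nu> i)"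
      "(\<integral>\<^sup>+ y. L (y i) \<partial>PiM {1..N} \<nu>) = linear_cost L (\<nu> i)"
      unfolding linear_cost_def using nn_integral_PiM_component[where M = \<nu>, OF prob i] by simp_all
  qed
  have H_int: "(\<integral>\<^sup>+ y. H (y i, y j) \<partial>PiM {1..N} \<nu>) = interaction_cost H (\<nu> i) (\<nu> j)"
    if "i \<in> {1..N}" "j \<in> {1..N}" "i \<noteq> j" for i j
  proof -
    have "sets (\<nu> i \<Otimes>\<^sub>M \<nu> j) = sets borel"
      unfolding borel_prod[symmetric] using that sets_mixed_profiles[OF \<nu>]
      by (intro sets_pair_measure_cong)
    then have "H \<in> borel_measurable (\<nu> i \<Otimes>\<^sub>M \<nu> j)"
      using borel_measurable_costs by (simp cong: measurable_cong_sets)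
    then show ?thesis
      unfolding interaction_cost_def using nn_integral_PiM_pair[where M = \<nu>, OF prob that] by simp
  qed
  note meas = cost_terms_measurable[OF \<nu>]
  have sum_meas: "(\<lambda>y. \<Sum>i\<in>{1..N}. c (x i, y i)) \<in> borel_measurable (PiM {1..N} \<nu>)"
    "(\<lambda>y. \<Sum>i\<in>{1..N}. L (y i)) \<in> borel_measurable (PiM {1..N} \<nu>)"
    "(\<lambda>y. \<Sum>i\<in>{1..N}. \<Sum>j\<in>{1..N} - {i}. H (y i, y j)) \<in> borel_measurable (PiM {1..N} \<nu>)"
    by (intro borel_measurable_sum meas; auto)+
  have "(\<integral>\<^sup>+ y. action_cost y \<partial>PiM {1..N} \<nu>)
      = (\<integral>\<^sup>+ y. (\<Sum>i\<in>{1..N}. c (x i, y i)) \<partial>PiM {1..N} \<nu>) / of_nat N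
      + (\<integral>\<^sup>+ y. (\<Sum>i\<in>{1..N}. L (y i)) \<partial>PiM {1..N} \<nu>) / of_nat N
      + (\<integral>\<^sup>+ y. (\<Sum>i\<in>{1..N}. \<Sum>j\<in>{1..N} - {i}. H (y i, y j)) \<partial>PiM {1..N} \<nu>) / (of_nat N)\<^sup>2"
    unfolding action_cost_def using sum_meas
    by (simp add: nn_integral_add nn_integral_divide del: One_nat_def)
  also have "\<dots> = profile_cost \<nu>"
  proof -
    have "(\<integral>\<^sup>+ y. (\<Sum>i\<in>{1..N}. c (x i, y i)) \<partial>PiM {1..N} \<nu>) = (\<Sum>i\<in>{1..N}. \<integral>\<^sup>+ z. c (x i, z) \<partial>\<nu> i)"
      using meas c_int by (subst nn_integral_sum) auto
    moreover have "(\<integral>\<^sup>+ y. (\<Sum>i\<in>{1..N}. L (y i)) \<partial>PiM {1..N} \<nu>) = (\<Sum>i\<in>{1..N}. linear_cost L (\<nu> i))"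
      using meas L_int by (subst nn_integral_sum) auto
    moreover have "(\<integral>\<^sup>+ y. (\<Sum>i\<in>{1..N}. \<Sum>j\<in>{1..N} - {i}. H (y i, y j)) \<partial>PiM {1..N} \<nu>)
        = (\<Sum>i\<in>{1..N}. \<integral>\<^sup>+ y. (\<Sum>j\<in>{1..N} - {i}. H (y i, y j)) \<partial>PiM {1..N} \<nu>)"
      by (intro nn_integral_sum borel_measurable_sum meas) auto
    moreover have "\<dots> = (\<Sum>i\<in>{1..N}. \<Sum>j\<in>{1..N} - {i}. \<integral>\<^sup>+ y. H (y i, y j) \<partial>PiM {1..N} \<nu>)"
      by (intro sum.cong refl nn_integral_sum meas) auto
    moreover have "\<dots> = (\<Sum>i\<in>{1..N}. \<Sum>j\<in>{1..N} - {i}. interaction_cost H (\<nu> i) (\<nu> j))"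
      by (intro sum.cong refl H_int) auto
    ultimately show ?thesis
      by (simp add: profile_cost_def)
  qed
  finally show ?thesis ..
qed

section \<open>Existence of minimizers\<close>

lemma lsc_action_cost: "lsc action_cost"
  unfolding action_cost_def[abs_def]
  by (intro lsc_add lsc_divide lsc_sum lsc_compose[OF lsc_c] lsc_compose[OF lsc_L] lsc_compose[OF lsc_H]
      continuous_intros)
    (use N_pos in \<open>simp_all add: of_nat_less_top flip: of_nat_power\<close>)

definition min_cost :: ennreal where
  "min_cost = (INF y\<in>pure_profiles N. action_cost y)"

lemma min_cost_le: "y \<in> pure_profiles N \<Longrightarrow> min_cost \<le> action_cost y"
  unfolding min_cost_def by (rule INF_lower)

text \<open>
The direct method: actions at least as good as a reference profile \<open>z\<close> of finite cost lie in
a product of compact sublevels of \<open>L\<close>, since every \<open>L (y i)\<close> is at most \<open>N\<close> times the total cost.  If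
all costs are infinite, any profile is a minimizer.
\<close>

lemma optimal_actions_exist:
  obtains y where "y \<in> pure_profiles N" "action_cost y = min_cost"
proof (cases "min_cost = \<top>")
  case True
  have "(\<lambda>i\<in>{1..N}. undefined) \<in> pure_profiles N" by simp
  with True that min_cost_le show ?thesis
    by (metis top_unique)
next
  case False
  then obtain z where z: "z \<in> pure_profiles N" "action_cost z < \<top>"
    unfolding min_cost_def less_top INF_less_iff by blast
  obtain \<kappa> where \<kappa>: "0 < \<kappa>" "of_nat N * action_cost z \<le> ennreal \<kappa>"
  proof -
    have "of_nat N * action_cost z < \<top>"
      using z(2) by (simp add: ennreal_mult_less_top of_nat_less_top)
    then obtain r where "of_nat N * action_cost z = ennreal r" "0 \<le> r"
      by (metis less_top_ennreal)
    then show ?thesis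
      \<comment> \<open>Adding 1 makes the level positive, as \<open>compact_sublevel\<close> demands.\<close>
      using that[of "r + 1"] by (simp add: ennreal_leI)
  qed
  let ?K = "{1..N} \<rightarrow>\<^sub>E {y. L y \<le> ennreal \<kappa>}"
  have K: "y \<in> ?K" if y: "y \<in> pure_profiles N" "action_cost y \<le> action_cost z" for y
  proof -
    have "L (y i) \<le> ennreal \<kappa>" if i: "i \<in> {1..N}" for i
    proof -
      have "L (y i) \<le> (\<Sum>i\<in>{1..N}. L (y i))"
        using i by (intro member_le_sum) auto
      also have "\<dots> = of_nat N * ((\<Sum>i\<in>{1..N}. L (y i)) / of_nat N)"
        using ennreal_divide_mult_of_nat[OF N_pos] by (metis mult.commute)
      also have "\<dots> \<le> of_nat N * action_cost y"
        unfolding action_cost_def by (intro mult_left_mono) (auto intro: add_increasing add_increasing2)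
      also have "\<dots> \<le> of_nat N * action_cost z"
        using y(2) by (rule mult_left_mono) simp
      finally show ?thesis
        using \<kappa>(2) by simp
    qed
    with y(1) show ?thesis by (auto simp: PiE_iff)
  qed
  have "compact ?K"
    using compact_sublevel[OF \<kappa>(1)] by (intro compact_extensional_PiE)
  moreover have "?K \<noteq> {}"
    using K[OF z(1)] by auto
  ultimately obtain y where y: "y \<in> ?K" "\<And>y'. y' \<in> ?K \<Longrightarrow> action_cost y \<le> action_cost y'"
    using lsc_attains_min_on_compact[OF lsc_action_cost] by blast
  have "action_cost y \<le> action_cost y'" if "y' \<in> pure_profiles N" for y'
  proof (cases "action_cost y' \<le> action_cost z")
    case True
    then show ?thesis using that by (intro y K)
  next
    case False
    then show ?thesis using y(2)[OF K[OF z(1)]] by simp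
  qed
  then have "action_cost y \<le> min_cost"
    unfolding min_cost_def by (rule INF_greatest)
  moreover have "y \<in> pure_profiles N"
    using y(1) by (auto simp: PiE_iff)
  ultimately show ?thesis
    using that min_cost_le by (metis antisym)
qed

lemma min_cost_le_profile_cost:
  assumes \<nu>: "\<nu> \<in> mixed_profiles N"
  shows "min_cost \<le> profile_cost \<nu>"
proof -
  interpret prob_space "PiM {1..N} \<nu>"
    by (intro prob_space_PiM prob_space_mixed_profiles[OF \<nu>])
  have "min_cost = (\<integral>\<^sup>+ y. min_cost \<partial>PiM {1..N} \<nu>)"
    by (simp add: emeasure_space_1 del: One_nat_def)
  also have "\<dots> \<le> (\<integral>\<^sup>+ y. action_cost y \<partial>PiM {1..N} \<nu>)"
    by (intro nn_integral_mono min_cost_le) (auto simp: space_PiM PiE_iff)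
  finally show ?thesis
    by (simp add: profile_cost_eq_expectation[OF \<nu>])
qed

lemma min_cost_le_mixed_cost: "min_cost \<le> mixed_cost c L H N x \<gamma>"
proof (cases "\<gamma> \<in> probs_with_marginal (empirical N x)")
  case True
  then obtain \<nu> where "\<nu> \<in> mixed_profiles N" "\<gamma> = plan_of N x \<nu>"
    by (rule plan_of_surj[OF N_pos distinct])
  then show ?thesis
    by (simp add: mixed_cost_plan_of min_cost_le_profile_cost)
qed (simp add: mixed_cost_def)

lemma argmin_pure_cost:
  "argmin_on (pure_profiles N) (pure_cost c L H N x) = {y \<in> pure_profiles N. action_cost y = min_cost}"
proof -
  obtain y where "y \<in> pure_profiles N" "action_cost y = min_cost"
    by (rule optimal_actions_exist)
  then show ?thesis
    unfolding pure_cost_eq_action_cost by (intro argmin_on_eq min_cost_le)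
qed

text \<open>
A single statement for the three feasible sets that occur: pure plans, plans with the given
marginal, and all Borel probability measures.  They share the value \<open>min_cost\<close> because the
lower bound holds for every measure and pure plans attain it.
\<close>

lemma argmin_mixed_cost:
  assumes "pure_plans N x \<subseteq> S"
  shows "argmin_on S (mixed_cost c L H N x) = {\<gamma> \<in> S. mixed_cost c L H N x \<gamma> = min_cost}"
    and "argmin_on S (mixed_cost c L H N x) \<noteq> {}"
    and "(INF \<gamma>\<in>S. mixed_cost c L H N x \<gamma>) = min_cost"
proof -
  obtain y where y: "y \<in> pure_profiles N" "action_cost y = min_cost"
    by (rule optimal_actions_exist)
  then have S: "pure_plan_of N x y \<in> S"
    using assms by (auto simp: pure_plans_def)
  have opt: "mixed_cost c L H N x (pure_plan_of N x y) = min_cost"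
    using y pure_cost_eq_action_cost by (simp add: pure_cost_def)
  show *: "argmin_on S (mixed_cost c L H N x) = {\<gamma> \<in> S. mixed_cost c L H N x \<gamma> = min_cost}"
    by (intro argmin_on_eq[where s = "pure_plan_of N x y"] min_cost_le_mixed_cost S opt)
  show "argmin_on S (mixed_cost c L H N x) \<noteq> {}"
    using S opt by (auto simp: *)
  show "(INF \<gamma>\<in>S. mixed_cost c L H N x \<gamma>) = min_cost"
    using S opt min_cost_le_mixed_cost by (metis INF_greatest INF_lower antisym)
qed

lemma pure_plans_subset_plans:
  "(pure_plans N x :: ('x \<times> 'y) measure set) \<subseteq> probs_with_marginal (empirical N x)"
proof -
  have "pure_plan_of N x y \<in> probs_with_marginal (empirical N x)" for y :: "nat \<Rightarrow> 'y"
    unfolding pure_plan_of_eq_plan_of[OF N_pos]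
    by (rule plan_of_has_marginal[OF N_pos return_profile])
  then show ?thesis
    unfolding pure_plans_def by blast
qed

lemma plans_subset_borel_probs:
  "(probs_with_marginal (empirical N x) :: ('x \<times> 'y) measure set) \<subseteq> borel_probs"
  by (auto simp: probs_with_marginal_def)

lemma plan_of_optimal_iff:
  assumes \<nu>: "\<nu> \<in> mixed_profiles N"
  shows "profile_cost \<nu> = min_cost
    \<longleftrightarrow> (AE y in PiM {1..N} \<nu>. y \<in> argmin_on (pure_profiles N) (pure_cost c L H N x))"
proof -
  interpret prob_space "PiM {1..N} \<nu>"
    by (intro prob_space_PiM prob_space_mixed_profiles[OF \<nu>])
  have space: "y \<in> pure_profiles N" if "y \<in> space (PiM {1..N} \<nu>)" for y
    using that by (auto simp: space_PiM PiE_iff)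
  have "profile_cost \<nu> = min_cost \<longleftrightarrow> (AE y in PiM {1..N} \<nu>. action_cost y = min_cost)"
    unfolding profile_cost_eq_expectation[OF \<nu>]
    by (intro nn_integral_eq_lower_bound_iff action_cost_measurable[OF \<nu>] min_cost_le space)
  also have "\<dots> \<longleftrightarrow> (AE y in PiM {1..N} \<nu>. y \<in> argmin_on (pure_profiles N) (pure_cost c L H N x))"
    by (intro AE_cong) (simp add: argmin_pure_cost space del: One_nat_def)
  finally show ?thesis .
qed

section \<open>Minimizers are Nash equilibria\<close>

lemma interaction_cost_sym:
  assumes "\<rho> \<in> borel_probs" "\<rho>' \<in> borel_probs"
  shows "interaction_cost H \<rho> \<rho>' = interaction_cost H \<rho>' \<rho>"
proof -
  have sets: "sets \<rho> = sets borel" "sets \<rho>' = sets borel"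
    and prob: "prob_space \<rho>" "prob_space \<rho>'"
    using assms by (simp_all add: space_prob_algebra)
  interpret pair_sigma_finite \<rho> \<rho>'
    using prob by (simp add: pair_sigma_finite_def prob_space_imp_sigma_finite)
  have "sets (\<rho> \<Otimes>\<^sub>M \<rho>') = sets borel" "sets (\<rho>' \<Otimes>\<^sub>M \<rho>) = sets borel"
    unfolding borel_prod[symmetric] by (intro sets_pair_measure_cong sets)+
  then have meas: "H \<in> borel_measurable (\<rho> \<Otimes>\<^sub>M \<rho>')" "H \<in> borel_measurable (\<rho>' \<Otimes>\<^sub>M \<rho>)"
    using borel_measurable_costs by (simp_all cong: measurable_cong_sets)
  have "interaction_cost H \<rho> \<rho>' = (\<integral>\<^sup>+ b. (\<integral>\<^sup>+ a. H (a, b) \<partial>\<rho>) \<partial>\<rho>')"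
    unfolding interaction_cost_def by (rule nn_integral_snd[OF meas(1), symmetric])
  also have "\<dots> = (\<integral>\<^sup>+ b. (\<integral>\<^sup>+ a. H (b, a) \<partial>\<rho>) \<partial>\<rho>')"
    by (simp only: H_sym)
  also have "\<dots> = interaction_cost H \<rho>' \<rho>"
    unfolding interaction_cost_def by (rule M1.nn_integral_fst[OF meas(2)])
  finally show ?thesis .
qed

text \<open>
The part of \<open>N\<close> times the mixed cost that does not involve the strategy of player \<open>i\<close>.
\<close>

definition others_cost :: "nat \<Rightarrow> (nat \<Rightarrow> 'y measure) \<Rightarrow> ennreal" where
  "others_cost i \<nu> = (\<Sum>j\<in>{1..N} - {i}. \<integral>\<^sup>+ y. c (x j, y) \<partial>\<nu> j)
     + (\<Sum>j\<in>{1..N} - {i}. linear_cost L (\<nu> j))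
     + (\<Sum>j\<in>{1..N} - {i}. \<Sum>k\<in>{1..N} - {i} - {j}. interaction_cost H (\<nu> j) (\<nu> k)) / of_nat N"

text \<open>
The mixed cost is a potential for the game: a unilateral deviation of player \<open>i\<close> leaves \<open>others_cost i\<close>
unchanged.
\<close>

lemma player_cost_plus_others_cost:
  assumes \<nu>: "\<nu> \<in> mixed_profiles N" and i: "i \<in> {1..N}"
  shows "of_nat N * profile_cost \<nu> = player_cost c L H N x i (\<nu> i) \<nu> + others_cost i \<nu>"
proof -
  define C where "C j = (\<integral>\<^sup>+ y. c (x j, y) \<partial>\<nu> j)" for j
  define l where "l j = linear_cost L (\<nu> j)" for j
  define h where "h j k = interaction_cost H (\<nu> j) (\<nu> k)" for j k
  let ?R = "\<Sum>j\<in>{1..N} - {i}. \<Sum>k\<in>{1..N} - {i} - {j}. h j k"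
  let ?S = "\<Sum>k\<in>{1..N} - {i}. h i k"
  have h_split: "(\<Sum>j\<in>{1..N}. \<Sum>k\<in>{1..N} - {j}. h j k) = ?S + ?S + ?R"
  proof (subst sum_double_off_diagonal[OF _ i])
    show "h j i = h i j" if "j \<in> {1..N} - {i}" for j
      unfolding h_def using that i \<nu> by (intro interaction_cost_sym) auto
  qed simp_all
  have cancel: "of_nat N * (a / of_nat N) = a" for a :: ennreal
    using ennreal_divide_mult_of_nat[OF N_pos] by (simp add: mult.commute)
  have "of_nat N * profile_cost \<nu>
      = of_nat N * (sum C {1..N} / of_nat N) + of_nat N * (sum l {1..N} / of_nat N)
        + of_nat N * ((\<Sum>j\<in>{1..N}. \<Sum>k\<in>{1..N} - {j}. h j k) / (of_nat N)\<^sup>2)"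
    unfolding profile_cost_def C_def l_def h_def by (simp only: distrib_left)
  also have "\<dots> = sum C {1..N} + sum l {1..N} + (?S + ?S + ?R) / of_nat N"
    by (simp only: cancel ennreal_of_nat_mult_divide_square[OF N_pos] h_split)
  also have "(?S + ?S + ?R) / of_nat N = 2 / of_nat N * ?S + ?R / of_nat N"
    by (simp only: mult_2[symmetric] divide_ennreal_def distrib_right mult.assoc
        mult.commute[of "inverse (of_nat N)" ?S])
  also have "sum C {1..N} = C i + sum C ({1..N} - {i})"
    using i by (intro sum.remove) simp_all
  also have "sum l {1..N} = l i + sum l ({1..N} - {i})"
    using i by (intro sum.remove) simp_all
  also have "C i + sum C ({1..N} - {i}) + (l i + sum l ({1..N} - {i})) + (2 / of_nat N * ?S + ?R / of_nat N)
      = (C i + l i + 2 / of_nat N * ?S) + (sum C ({1..N} - {i}) + sum l ({1..N} - {i}) + ?R / of_nat N)"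
    by (simp only: ac_simps)
  finally show ?thesis
    unfolding player_cost_def others_cost_def C_def l_def h_def .
qed

text \<open>
Finiteness of the minimum makes \<open>others_cost i \<nu>\<close> finite, so that it can be cancelled from the
potential inequality.
\<close>

lemma minimal_profile_is_nash:
  assumes \<nu>: "\<nu> \<in> mixed_profiles N" and opt: "profile_cost \<nu> = min_cost" and fin: "min_cost < \<top>"
  shows "nash_equilibrium c L H N x \<nu>"
  unfolding nash_equilibrium_def
proof (intro ballI conjI)
  fix i assume i: "i \<in> {1..N}"
  then show "\<nu> i \<in> borel_probs" using \<nu> by auto
  fix \<rho> :: "'y measure" assume \<rho>: "\<rho> \<in> borel_probs"
  let ?\<nu>' = "\<nu>(i := \<rho>)"
  have \<nu>': "?\<nu>' \<in> mixed_profiles N"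
    using \<nu> \<rho> i by (auto simp: PiE_iff extensional_def)
  have others: "others_cost i ?\<nu>' = others_cost i \<nu>"
    unfolding others_cost_def by (intro arg_cong2[of _ _ _ _ "(+)"] arg_cong2[of _ _ _ _ "(/)"] sum.cong refl) auto
  have player: "player_cost c L H N x i \<rho> ?\<nu>' = player_cost c L H N x i \<rho> \<nu>"
    unfolding player_cost_def by (intro arg_cong2[of _ _ _ _ "(+)"] arg_cong2[of _ _ _ _ "(*)"] sum.cong refl) auto
  have "player_cost c L H N x i (\<nu> i) \<nu> + others_cost i \<nu> = of_nat N * min_cost"
    using player_cost_plus_others_cost[OF \<nu> i] opt by simp
  moreover have "of_nat N * min_cost \<le> of_nat N * profile_cost ?\<nu>'"
    by (intro mult_left_mono min_cost_le_profile_cost \<nu>') simp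
  moreover have "of_nat N * profile_cost ?\<nu>' = player_cost c L H N x i \<rho> \<nu> + others_cost i \<nu>"
    using player_cost_plus_others_cost[OF \<nu>' i] by (simp add: others player)
  ultimately have le: "player_cost c L H N x i (\<nu> i) \<nu> + others_cost i \<nu>
      \<le> player_cost c L H N x i \<rho> \<nu> + others_cost i \<nu>"
    and total: "player_cost c L H N x i (\<nu> i) \<nu> + others_cost i \<nu> = of_nat N * min_cost"
    by simp_all
  have "of_nat N * min_cost < \<top>"
    using fin by (simp add: ennreal_mult_less_top of_nat_less_top)
  then have "others_cost i \<nu> \<noteq> \<top>"
    unfolding total[symmetric] by auto
  then show "player_cost c L H N x i (\<nu> i) \<nu> \<le> player_cost c L H N x i \<rho> \<nu>"
    using le by (simp add: add.commute[of _ "others_cost i \<nu>"] ennreal_add_left_cancel_le)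
qed

lemma minimizing_actions_are_nash:
  assumes "action_cost y = min_cost" "min_cost < \<top>"
  shows "nash_equilibrium c L H N x (\<lambda>i. return borel (y i))"
proof -
  have "profile_cost (\<lambda>i\<in>{1..N}. return borel (y i)) = min_cost"
    using assms(1) pure_cost_eq_action_cost[of y]
    by (simp add: pure_cost_def pure_plan_of_eq_plan_of[OF N_pos] mixed_cost_plan_of[OF return_profile] del: One_nat_def)
  from minimal_profile_is_nash[OF return_profile this assms(2)]
  have "nash_equilibrium c L H N x (\<lambda>i\<in>{1..N}. return borel (y i))" .
  moreover have "player_cost c L H N x i \<rho> (\<lambda>i\<in>{1..N}. return borel (y i))
      = player_cost c L H N x i \<rho> (\<lambda>i. return borel (y i))" for i \<rho>
    unfolding player_cost_def by (intro arg_cong2[of _ _ _ _ "(+)"] arg_cong2[of _ _ _ _ "(*)"] sum.cong refl) auto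
  ultimately show ?thesis
    by (simp add: nash_equilibrium_def)
qed

end

section \<open>The almost sure statement\<close>

theorem proposition4p8:
  fixes \<mu> :: "'x::polish_space measure"
    and c :: "'x \<times> 'y::polish_space \<Rightarrow> ennreal"
    and L :: "'y \<Rightarrow> ennreal"
    and H :: "'y \<times> 'y \<Rightarrow> ennreal"
    and P :: "'w measure"
    and X :: "nat \<Rightarrow> 'w \<Rightarrow> 'x"
    and N :: nat
  assumes "\<mu> \<in> borel_probs" and "atomless \<mu>"
    and "lsc c" and "lsc L" and "lsc H"
    and "\<And>y y'. H (y, y') = H (y', y)"
    and "\<And>\<kappa>::real. \<kappa> > 0 \<Longrightarrow> compact {y. L y \<le> ennreal \<kappa>}"
    and "prob_space P"
    and "prob_space.indep_vars P (\<lambda>_. borel) X UNIV"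
    and "\<And>i. distr P borel (X i) = \<mu>"
    and "N > 0"
  shows "AE \<omega> in P.
    (let x = (\<lambda>i. X i \<omega>);
         J = pure_cost c L H N x;
         JJ = mixed_cost c L H N x;
         plans = probs_with_marginal (empirical N x)
     in
       ((\<forall>y\<in>pure_profiles N.
            y \<in> argmin_on (pure_profiles N) J
              \<longleftrightarrow> pure_plan_of N x y \<in> argmin_on borel_probs JJ)
        \<and> (\<forall>\<nu>\<in>mixed_profiles N.
            plan_of N x \<nu> \<in> argmin_on borel_probs JJ
              \<longleftrightarrow> (AE y in PiM {1..N} \<nu>. y \<in> argmin_on (pure_profiles N) J))
        \<and> argmin_on (pure_profiles N) J \<noteq> {}
        \<and> argmin_on (pure_plans N x) JJ \<noteq> {}
        \<and> argmin_on plans JJ \<noteq> {}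
        \<and> (INF y\<in>pure_profiles N. J y) = (INF \<gamma>\<in>pure_plans N x. JJ \<gamma>)
        \<and> (INF \<gamma>\<in>pure_plans N x. JJ \<gamma>) = (INF \<gamma>\<in>plans. JJ \<gamma>))
     \<and>
       ((\<forall>y\<in>argmin_on (pure_profiles N) J.
            J y < \<infinity> \<longrightarrow> nash_equilibrium c L H N x (\<lambda>i. return borel (y i)))
        \<and> (\<forall>\<nu>\<in>mixed_profiles N.
            plan_of N x \<nu> \<in> argmin_on borel_probs JJ \<and> JJ (plan_of N x \<nu>) < \<infinity>
              \<longrightarrow> nash_equilibrium c L H N x \<nu>)))"
proof -
  have "AE \<omega> in P. i \<noteq> j \<longrightarrow> X i \<omega> \<noteq> X j \<omega>" for i j
    using AE_iid_atomless_distinct[OF assms(8,9,10,2)] by (cases "i = j") simp_all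
  then have "AE \<omega> in P. \<forall>i j. i \<noteq> j \<longrightarrow> X i \<omega> \<noteq> X j \<omega>"
    by (simp add: AE_all_countable)
  then show ?thesis
  proof eventually_elim
    case (elim \<omega>)
    define x where "x = (\<lambda>i. X i \<omega>)"
    have "inj_on x {1..N}"
      using elim by (auto simp: x_def inj_on_def)
    interpret N_player_game c L H N x
      by (rule N_player_game.intro) fact+
    have pure_opt: "mixed_cost c L H N x (pure_plan_of N x y) = action_cost y" for y
      using pure_cost_eq_action_cost[of y] by (simp add: pure_cost_def)
    have plan_prob: "pure_plan_of N x y \<in> borel_probs" if "y \<in> pure_profiles N" for y :: "nat \<Rightarrow> 'y"
      using that pure_plans_subset_plans plans_subset_borel_probs by (auto simp: pure_plans_def)
    have plan_of_prob: "plan_of N x \<nu> \<in> borel_probs" if "\<nu> \<in> mixed_profiles N" for \<nu> :: "nat \<Rightarrow> 'y measure"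
      using that plan_of_has_marginal[OF N_pos] plans_subset_borel_probs by blast
    note argmin_all = argmin_mixed_cost[OF order_trans[OF pure_plans_subset_plans plans_subset_borel_probs]]
      and argmin_plans = argmin_mixed_cost[OF pure_plans_subset_plans]
      and argmin_pure = argmin_mixed_cost[OF order_refl]
    have INF_pure: "(INF y\<in>pure_profiles N. pure_cost c L H N x y) = min_cost"
      by (simp add: pure_cost_eq_action_cost min_cost_def)
    show ?case
      unfolding Let_def x_def[symmetric]
    proof (intro conjI ballI impI)
      fix y :: "nat \<Rightarrow> 'y" assume "y \<in> pure_profiles N"
      then show "y \<in> argmin_on (pure_profiles N) (pure_cost c L H N x)
          \<longleftrightarrow> pure_plan_of N x y \<in> argmin_on borel_probs (mixed_cost c L H N x)"
        using plan_prob unfolding argmin_pure_cost argmin_all(1) by (simp add: pure_opt)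
    next
      fix \<nu> :: "nat \<Rightarrow> 'y measure" assume \<nu>: "\<nu> \<in> mixed_profiles N"
      then have "plan_of N x \<nu> \<in> argmin_on borel_probs (mixed_cost c L H N x) \<longleftrightarrow> profile_cost \<nu> = min_cost"
        using plan_of_prob unfolding argmin_all(1) by (simp add: mixed_cost_plan_of)
      then show "plan_of N x \<nu> \<in> argmin_on borel_probs (mixed_cost c L H N x)
          \<longleftrightarrow> (AE y in PiM {1..N} \<nu>. y \<in> argmin_on (pure_profiles N) (pure_cost c L H N x))"
        by (simp only: plan_of_optimal_iff[OF \<nu>])
    next
      show "argmin_on (pure_profiles N) (pure_cost c L H N x) \<noteq> {}"
        using optimal_actions_exist unfolding argmin_pure_cost by blast
      show "argmin_on (pure_plans N x) (mixed_cost c L H N x) \<noteq> {}"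
        by (rule argmin_pure(2))
      show "argmin_on (probs_with_marginal (empirical N x)) (mixed_cost c L H N x) \<noteq> {}"
        by (rule argmin_plans(2))
      show "(INF y\<in>pure_profiles N. pure_cost c L H N x y) = (INF \<gamma>\<in>pure_plans N x. mixed_cost c L H N x \<gamma>)"
        by (simp only: INF_pure argmin_pure(3))
      show "(INF \<gamma>\<in>pure_plans N x. mixed_cost c L H N x \<gamma>)
          = (INF \<gamma>\<in>probs_with_marginal (empirical N x). mixed_cost c L H N x \<gamma>)"
        by (simp only: argmin_pure(3) argmin_plans(3))
    next
      fix y assume "y \<in> argmin_on (pure_profiles N) (pure_cost c L H N x)" "pure_cost c L H N x y < \<infinity>"
      then show "nash_equilibrium c L H N x (\<lambda>i. return borel (y i))"
        unfolding argmin_pure_cost pure_cost_eq_action_cost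
        by (intro minimizing_actions_are_nash) auto
    next
      fix \<nu> assume \<nu>: "\<nu> \<in> mixed_profiles N"
        and "plan_of N x \<nu> \<in> argmin_on borel_probs (mixed_cost c L H N x)
          \<and> mixed_cost c L H N x (plan_of N x \<nu>) < \<infinity>"
      then show "nash_equilibrium c L H N x \<nu>"
        unfolding argmin_all(1) by (intro minimal_profile_is_nash) (auto simp: mixed_cost_plan_of)
    qed
  qed
qed

end
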